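(* Let $n\in\mathbb{N}$, $n\geq 1$, be even, and let $T\in GL(n+1,\mathbb{R})$ be an isometry (with respect to the Euclidean norm). Then there exists $a\in\mathbb{R}^{n+1}$ such that $0<\|T^{-1}(a)\|<1$ and the homeomorphism $\overline{T}_a$ of $\mathbb{S}^n$ is not distal.
   Context: $\|\cdot\|$ is the Euclidean norm on $\mathbb{R}^{n+1}$ and $\mathbb{S}^n$ its unit sphere. For $T\in GL(n+1,\mathbb{R})$ and $a\in\mathbb{R}^{n+1}\setminus\{0\}$ with $\|T^{-1}(a)\|<1$, the map $\overline{T}_a:\mathbb{S}^n\to\mathbb{S}^n$ is defined by $\overline{T}_a(x)=(a+T(x))/\|a+T(x)\|$; it is a well-defined homeomorphism. A homeomorphism $S$ of a Hausdorff space $X$ is distal if for every pair of distinct points $x,y\in X$, the closure of $\{(S^m(x),S^m(y))\mid m\in\mathbb{Z}\}$ in $X\times X$ does not intersect the diagonal $\{(d,d)\mid d\in X\}$. *)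

theory Defs
  imports "HOL-Analysis.Analysis"
begin

(* The integer iterates S^m of a bijection S of the set X; negative powers use the
   inverse of S on X, since S need not be injective outside X. *)
definition int_iterate :: "'a set \<Rightarrow> ('a \<Rightarrow> 'a) \<Rightarrow> int \<Rightarrow> 'a \<Rightarrow> 'a" where
  "int_iterate X S m =
     (if 0 \<le> m then S ^^ nat m else (inv_into X S) ^^ nat (- m))"

(* Intended for a Hausdorff space X and a homeomorphism S of X.  These requirements are not
   part of the definition, so that the negation of distal expresses only the failure of the
   closure condition. *)
definition distal :: "'a topology \<Rightarrow> ('a \<Rightarrow> 'a) \<Rightarrow> bool" where
  "distal X S \<longleftrightarrow>
     (\<forall>x \<in> topspace X. \<forall>y \<in> topspace X. x \<noteq> y \<longrightarrow>
        (prod_topology X X closure_of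
           {(int_iterate (topspace X) S m x, int_iterate (topspace X) S m y) | m :: int. True})
        \<inter> {(d, d) | d. d \<in> topspace X} = {})"

definition affine_sphere_map :: "real^'d^'d \<Rightarrow> real^'d \<Rightarrow> real^'d \<Rightarrow> real^'d" where
  "affine_sphere_map T a x = (1 / norm (a + T *v x)) *\<^sub>R (a + T *v x)"

end

theory Submission
  imports Defs
begin

text \<open>
  In odd dimension the orthogonal matrix \<open>T\<close> has a unit eigenvector \<open>v\<close> with eigenvalue
  \<open>d = det T = \<plusminus>1\<close>. Take \<open>a = t v\<close> with \<open>0 < t < 1\<close> and let \<open>S\<close> be the induced map. With
  \<open>N = norm (a + T x)\<close>, passing from \<open>x\<close> to \<open>S x\<close> divides the distance to the axis of \<open>v\<close>
  by \<open>N\<close>. If \<open>d = 1\<close>, then \<open>S v = v\<close> and the forward orbits of points with \<open>v \<bullet> x \<ge> 0\<close> converge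
  to \<open>v\<close> since there \<open>N\<^sup>2 \<ge> 1 + t\<^sup>2\<close>. If \<open>d = -1\<close>, then \<open>S\<close> swaps \<open>v\<close> and \<open>-v\<close>, and this
  2-periodic orbit is repelling, so that the even backward iterates of points near \<open>v\<close>
  converge to \<open>v\<close>. In both cases \<open>v\<close> and such a point form a pair violating distality.
\<close>

section \<open>Real eigenvectors in odd dimension\<close>

lemma orthogonal_transformation_matrix_vector_mult:
  fixes A :: "real^'n^'n"
  shows "orthogonal_transformation ((*v) A) \<longleftrightarrow> orthogonal_matrix A"
  by (simp add: orthogonal_transformation_matrix)

lemma det_scaleR:
  fixes A :: "real^'n^'n"
  shows "det (k *\<^sub>R A) = k ^ CARD('n) * det A"
proof -
  have "k *\<^sub>R A = matrix ((*\<^sub>R) k) ** A"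
    unfolding matrix_eq
    by (simp add: matrix_vector_mul_assoc[symmetric] linear_scaleR scaleR_matrix_vector_assoc[symmetric]
        matrix_works)
  then show ?thesis by (simp add: det_mul)
qed

text \<open>With \<open>d = det Q\<close> and \<open>B = Q - d I\<close>, orthogonality and
  \<open>d * d = 1\<close> give \<open>Q B^T = I - d Q = - d B\<close>. In odd dimension the
  determinants of the two sides are \<open>d * det B\<close> and \<open>- d * det B\<close>, so
  \<open>B\<close> is singular, and its kernel consists of vectors scaled by \<open>d\<close> under
  \<open>Q\<close>.\<close>

lemma orthogonal_matrix_real_eigenvector:
  fixes Q :: "real^'n^'n"
  assumes Q: "orthogonal_matrix Q" and odd: "odd CARD('n)"
  obtains v where "norm v = 1" "Q *v v = det Q *\<^sub>R v"
proof -
  define d where "d = det Q"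
  define B where "B = Q - d *\<^sub>R mat 1"
  have d: "d * d = 1"
    using det_orthogonal_matrix[OF Q] by (auto simp: d_def)
  have QQ: "Q ** transpose Q = mat 1"
    using Q by (simp add: orthogonal_matrix_def)
  have "transpose B = transpose Q - d *\<^sub>R mat 1"
    by (simp add: B_def transpose_def mat_def vec_eq_iff)
  then have "(Q ** transpose B) *v x = ((- d) *\<^sub>R B) *v x" for x
  proof -
    have "Q *v (transpose Q *v x) = x"
      by (simp add: matrix_vector_mul_assoc QQ del: transpose_matrix_vector)
    moreover have "(Q ** transpose B) *v x = Q *v (transpose Q *v x) - d *\<^sub>R (Q *v x)"
      unfolding matrix_vector_mul_assoc[symmetric] \<open>transpose B = _\<close> matrix_vector_mult_diff_rdistrib
        matrix_vector_mult_diff_distrib scaleR_matrix_vector_assoc[symmetric]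
      by (simp add: matrix_vector_mult_scaleR del: transpose_matrix_vector)
    moreover have "((- d) *\<^sub>R B) *v x = x - d *\<^sub>R (Q *v x)"
      unfolding B_def scaleR_matrix_vector_assoc[symmetric] matrix_vector_mult_diff_rdistrib
      using d by (simp add: algebra_simps)
    ultimately show ?thesis by simp
  qed
  then have "Q ** transpose B = (- d) *\<^sub>R B"
    by (simp add: matrix_eq)
  then have "det (Q ** transpose B) = det ((- d) *\<^sub>R B)"
    by simp
  then have "d * det B = (- d) ^ CARD('n) * det B"
    by (simp only: det_mul det_scaleR det_transpose d_def)
  moreover have "(- d) ^ CARD('n) = - d"
  proof -
    have "d = 1 \<or> d = -1"
      using det_orthogonal_matrix[OF Q] by (simp add: d_def)
    then show ?thesis using odd by auto
  qed
  ultimately have "det B = 0"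
    using d by auto
  then have "\<not> (\<exists>C. C ** B = mat 1)"
    using invertible_det_nz invertible_left_inverse by blast
  then obtain x where x: "B *v x = 0" "x \<noteq> 0"
    unfolding matrix_left_invertible_ker by blast
  then have "Q *v x = d *\<^sub>R x"
    by (simp add: B_def matrix_vector_mult_diff_rdistrib scaleR_matrix_vector_assoc[symmetric])
  with x show thesis
    by (intro that[of "(1 / norm x) *\<^sub>R x"]) (auto simp: matrix_vector_mult_scaleR d_def)
qed

section \<open>Convergence criteria\<close>

text \<open>A common limit along any sequence of integer times puts a diagonal point into the
  closure of the orbit of the pair. The free choice of \<open>k\<close> admits forward times as well
  as even backward times.\<close>

lemma not_distalI:
  fixes X :: "'a::metric_space set" and k :: "nat \<Rightarrow> int"
  assumes "x \<in> X" "y \<in> X" "x \<noteq> y" "d \<in> X"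
    and inX: "\<And>m. int_iterate X S (k m) x \<in> X" "\<And>m. int_iterate X S (k m) y \<in> X"
    and lim: "(\<lambda>m. int_iterate X S (k m) x) \<longlonglongrightarrow> d" "(\<lambda>m. int_iterate X S (k m) y) \<longlonglongrightarrow> d"
  shows "\<not> distal (top_of_set X) S"
proof -
  define O' where "O' = {(int_iterate X S m x, int_iterate X S m y) | m. True}"
  have "(d, d) \<in> closure (X \<times> X \<inter> O')"
    unfolding closure_sequential
    by (rule exI[of _ "\<lambda>m. (int_iterate X S (k m) x, int_iterate X S (k m) y)"])
       (use inX lim in \<open>auto simp: O'_def intro: tendsto_Pair\<close>)
  then have "(d, d) \<in> prod_topology (top_of_set X) (top_of_set X) closure_of O'"
    using \<open>d \<in> X\<close> by (simp add: closure_of_subtopology)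
  then show ?thesis
    using assms(1-4) unfolding distal_def O'_def by (auto simp: disjoint_iff)
qed

text \<open>For unit vectors at height \<open>c = v \<bullet> y m\<close>, the squared distance to
  \<open>v\<close> is \<open>2 * (1 - c)\<close>. Since \<open>0 \<le> c \<le> 1\<close>, this is at
  most \<open>2 * (1 - c^2)\<close>; the sign condition keeps the sequence away from
  \<open>- v\<close>.\<close>

lemma unit_vectors_tendsto:
  fixes v :: "'a::real_inner"
  assumes "norm v = 1" "\<And>m. norm (y m) = 1" "\<And>m. 0 \<le> v \<bullet> y m"
    and le: "\<And>m. 1 - (v \<bullet> y m)\<^sup>2 \<le> q ^ m" and q: "0 \<le> q" "q < 1"
  shows "y \<longlonglongrightarrow> v"
proof -
  have bound: "(norm (y m - v))\<^sup>2 \<le> 2 * q ^ m" for m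
  proof -
    have c1: "v \<bullet> y m \<le> 1"
      using norm_cauchy_schwarz[of v "y m"] assms(1,2) by simp
    have "(norm (y m - v))\<^sup>2 = 2 - 2 * (v \<bullet> y m)"
      using assms(1) assms(2)[of m]
      by (simp add: power2_norm_eq_inner inner_diff inner_commute norm_eq_1)
    moreover have "(v \<bullet> y m)\<^sup>2 \<le> v \<bullet> y m"
      using c1 assms(3)[of m] by (simp add: power2_eq_square mult_left_le)
    ultimately show ?thesis using le[of m] by linarith
  qed
  have "(\<lambda>m. 2 * q ^ m) \<longlonglongrightarrow> 0"
    using LIMSEQ_realpow_zero[OF q] by (auto intro: tendsto_mult_right_zero)
  then have "(\<lambda>m. (norm (y m - v))\<^sup>2) \<longlonglongrightarrow> 0"
    by (rule tendsto_sandwich[OF _ _ tendsto_const, rotated 2]) (auto simp: bound)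
  then have "(\<lambda>m. norm (y m - v)) \<longlonglongrightarrow> 0"
    by simp
  then show ?thesis
    by (simp add: tendsto_norm_zero_iff LIM_zero_iff)
qed

section \<open>The induced map is a homeomorphism of the sphere\<close>

lemma homeomorphic_map_affine_sphere_map:
  fixes T :: "real^'d^'d"
  assumes T: "orthogonal_matrix T" and a: "norm a < 1"
  shows "homeomorphic_map (top_of_set (sphere 0 1)) (top_of_set (sphere 0 1)) (affine_sphere_map T a)"
proof -
  have TT: "transpose T *v (T *v x) = x" "T *v (transpose T *v x) = x" for x
    using T by (simp_all add: orthogonal_matrix_def matrix_vector_mul_assoc
        del: transpose_matrix_vector)
  have nT: "norm (T *v x) = norm x" for x
    using T by (simp add: orthogonal_transformation_norm flip: orthogonal_transformation_matrix_vector_mult)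
  have nT': "norm (transpose T *v x) = norm x" for x
    by (metis TT(2) nT)
  \<comment> \<open>\<open>s y\<close> is the positive root \<open>r\<close> of
    \<open>norm (r y - a) = 1\<close>, so that \<open>s y * y\<close> is where the ray through
    \<open>y\<close> meets the unit sphere centred at \<open>a\<close>. The roots have product
    \<open>(norm a)^2 - 1 < 0\<close>, hence exactly one is positive.\<close>
  define s where "s y = a \<bullet> y + sqrt ((a \<bullet> y)\<^sup>2 + (1 - (norm a)\<^sup>2))" for y
  define g where "g y = transpose T *v (s y *\<^sub>R y - a)" for y
  have a2: "(norm a)\<^sup>2 < 1" using a by (simp add: power_less_one_iff)
  have nz: "a + T *v x \<noteq> 0" if "norm x = 1" for x
    using that a nT[of x] by (metis add_eq_0_iff norm_minus_cancel less_irrefl)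
  have spos: "s y > 0" for y
  proof -
    have "sqrt ((a \<bullet> y)\<^sup>2) < sqrt ((a \<bullet> y)\<^sup>2 + (1 - (norm a)\<^sup>2))"
      using a2 by (simp only: real_sqrt_less_iff)
    then show ?thesis unfolding s_def by simp
  qed
  have sq: "(s y)\<^sup>2 - 2 * s y * (a \<bullet> y) + (norm a)\<^sup>2 = 1" for y
  proof -
    have "(s y - a \<bullet> y)\<^sup>2 = (a \<bullet> y)\<^sup>2 + (1 - (norm a)\<^sup>2)"
      using a2 by (simp add: s_def)
    then show ?thesis by (simp add: power2_eq_square algebra_simps)
  qed
  have expand: "(norm (r *\<^sub>R y - a))\<^sup>2 = r\<^sup>2 - 2 * r * (a \<bullet> y) + (norm a)\<^sup>2" if "norm y = 1" for r y
    using that unfolding power2_norm_eq_inner norm_eq_1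
    by (simp add: inner_diff inner_commute power2_eq_square algebra_simps)
  have ng: "norm (g y) = 1" if "norm y = 1" for y
  proof -
    have "(norm (s y *\<^sub>R y - a))\<^sup>2 = 1" using expand[OF that, of "s y"] sq[of y] by simp
    then show ?thesis
      unfolding g_def nT' by (metis abs_norm_cancel power2_eq_1_iff abs_minus_cancel abs_one)
  qed
  have nS: "norm (affine_sphere_map T a x) = 1" if "norm x = 1" for x
    using nz[OF that] by (simp add: affine_sphere_map_def)
  have gS: "g (affine_sphere_map T a x) = x" if x: "norm x = 1" for x
  proof -
    define r where "r = norm (a + T *v x)"
    define y where "y = affine_sphere_map T a x"
    have r: "r > 0" using nz[OF x] by (simp add: r_def)
    have ry: "r *\<^sub>R y = a + T *v x" using r by (simp add: y_def affine_sphere_map_def r_def)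
    have "norm y = 1" using nS[OF x] by (simp add: y_def)
    moreover have "r *\<^sub>R y - a = T *v x" by (simp add: ry)
    ultimately have "r\<^sup>2 - 2 * r * (a \<bullet> y) + (norm a)\<^sup>2 = 1"
      using expand[of y r] nT[of x] x by simp
    \<comment> \<open>Subtracting the quadratic equations of \<open>r\<close> and \<open>s y\<close>
      gives \<open>(r - s y) * (r + s y - 2 * (a \<bullet> y)) = 0\<close>. Multiplying by
      \<open>s y\<close> and using \<open>sq\<close> turns the second factor into one that is
      visibly positive.\<close>
    then have "(r - s y) * (r * s y + (1 - (norm a)\<^sup>2)) = 0"
      using sq[of y] by algebra
    moreover have "r * s y + (1 - (norm a)\<^sup>2) > 0"
      using r spos[of y] a2 by (simp add: add_pos_pos)
    ultimately have "s y = r" by simp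
    then show ?thesis using ry by (simp add: g_def y_def[symmetric] TT del: transpose_matrix_vector)
  qed
  have Sg: "affine_sphere_map T a (g y) = y" if "norm y = 1" for y
    using that spos[of y] by (simp add: affine_sphere_map_def g_def TT del: transpose_matrix_vector)
  have contS: "continuous_on (sphere 0 1) (affine_sphere_map T a)"
    unfolding affine_sphere_map_def using nz
    by (intro continuous_intros) auto
  have contg: "continuous_on (sphere 0 1) g"
    unfolding g_def s_def
    by (rule continuous_on_compose2[OF matrix_vector_mult_linear_continuous_on[of UNIV]])
       (intro continuous_intros | simp)+
  have "homeomorphic_maps (top_of_set (sphere 0 1)) (top_of_set (sphere 0 1)) (affine_sphere_map T a) g"
    unfolding homeomorphic_maps_def
    using contS contg nS ng gS Sg by (auto simp: continuous_map_in_subtopology)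
  then show ?thesis by (rule homeomorphic_maps_imp_map)
qed

section \<open>Heights along the axis of an eigenvector\<close>

text \<open>As \<open>T\<close> preserves inner products and scales \<open>v\<close> by
  \<open>d\<close>, it sends height \<open>v \<bullet> x\<close> to
  \<open>d * (v \<bullet> x)\<close>; thus \<open>N\<close> and the new height depend on the old
  height alone. The last equation concerns the squared distance to the axis, which \<open>T\<close>
  and the translation along \<open>v\<close> preserve, so that only the division by \<open>N\<close>
  changes it.\<close>

lemma affine_sphere_map_inner:
  fixes T :: "real^'d^'d" and d :: real
  assumes T: "orthogonal_matrix T" and v: "norm v = 1" "T *v v = d *\<^sub>R v" and d: "d\<^sup>2 = 1"
    and x: "norm x = 1" and t: "0 < t" "t < 1"
  defines "N \<equiv> norm (t *\<^sub>R v + T *v x)"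
  shows "0 < N"
    and "N\<^sup>2 = 1 + t\<^sup>2 + 2 * t * d * (v \<bullet> x)"
    and "v \<bullet> affine_sphere_map T (t *\<^sub>R v) x = (t + d * (v \<bullet> x)) / N"
    and "1 - (v \<bullet> affine_sphere_map T (t *\<^sub>R v) x)\<^sup>2 = (1 - (v \<bullet> x)\<^sup>2) / N\<^sup>2"
proof -
  have iT: "(T *v x) \<bullet> (T *v y) = x \<bullet> y" for x y
    using T orthogonal_transformation_matrix_vector_mult orthogonal_transformation_def by blast
  have vv: "v \<bullet> v = 1" "x \<bullet> x = 1" using v x by (simp_all add: norm_eq_1)
  have eq: "d * (v \<bullet> (T *v x)) = v \<bullet> x" using iT[of v x] v by simp
  have "v \<bullet> (T *v x) = d\<^sup>2 * (v \<bullet> (T *v x))" by (simp add: d)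
  also have "\<dots> = d * (v \<bullet> x)" unfolding power2_eq_square mult.assoc eq ..
  finally have vT: "v \<bullet> (T *v x) = d * (v \<bullet> x)" .
  show N2: "N\<^sup>2 = 1 + t\<^sup>2 + 2 * t * d * (v \<bullet> x)"
    unfolding N_def power2_norm_eq_inner
    using vT vv iT[of x x] by (simp add: inner_add inner_commute power2_eq_square algebra_simps)
  have nTx: "norm (T *v x) = 1" using iT[of x x] vv by (simp add: norm_eq_1)
  have "norm (T *v x) - norm (t *\<^sub>R v) \<le> N"
    unfolding N_def using norm_triangle_ineq2[of "T *v x" "- (t *\<^sub>R v)"] by (simp add: add.commute)
  then show N: "0 < N" using nTx v t by simp
  show c: "v \<bullet> affine_sphere_map T (t *\<^sub>R v) x = (t + d * (v \<bullet> x)) / N"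
    using vT vv by (simp add: affine_sphere_map_def N_def inner_add)
  have "N\<^sup>2 - (t + d * (v \<bullet> x))\<^sup>2 = 1 - (v \<bullet> x)\<^sup>2" using N2 d by algebra
  then show "1 - (v \<bullet> affine_sphere_map T (t *\<^sub>R v) x)\<^sup>2 = (1 - (v \<bullet> x)\<^sup>2) / N\<^sup>2"
    unfolding c using N by (simp add: field_simps)
qed

text \<open>
  Here \<open>N\<close> and \<open>M\<close> are the normalising factors of two consecutive steps when \<open>T v = - v\<close>;
  they lie on opposite sides of \<open>1\<close>, and two steps multiply the distance to the axis of \<open>v\<close>
  by \<open>1 / (N * M)\<close>.
\<close>

lemma two_step_factors:
  fixes t N M c :: real
  assumes t: "0 < t" "t < 1" and N: "0 < N" "N\<^sup>2 = 1 + t\<^sup>2 - 2 * t * c"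
    and M: "0 < M" "M\<^sup>2 = 1 + t\<^sup>2 - 2 * t * ((t - c) / N)"
  shows "M < 1 \<longleftrightarrow> 1 < N" and "1 < M \<longleftrightarrow> N < 1"
    and "N < 1 \<Longrightarrow> (N * M)\<^sup>2 \<le> 1 - (1 - N)\<^sup>2"
proof -
  have "N * (M\<^sup>2 - 1) = N * t\<^sup>2 - 2 * t * (t - c)"
    using N M by (simp add: field_simps)
  \<comment> \<open>Eliminating \<open>c\<close> by \<open>2 * t * c = 1 + t^2 - N^2\<close> brings
    out the factor \<open>1 - N\<close>. The cofactor is positive, so \<open>M - 1\<close> has the
    sign of \<open>1 - N\<close>.\<close>
  also have "\<dots> = (1 - N) * (1 + N - t\<^sup>2)"
    using N(2) by algebra
  finally have key: "N * ((M - 1) * (M + 1)) = (1 - N) * (1 + N - t\<^sup>2)"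
    by (simp add: power2_eq_square algebra_simps)
  have t2: "t\<^sup>2 < 1" using t by (simp add: power_less_one_iff)
  have pos: "1 + N - t\<^sup>2 > 0" using t2 N by linarith
  have k: "(M - 1) * (N * (M + 1)) = (1 - N) * (1 + N - t\<^sup>2)"
    using key by (simp add: ac_simps)
  have NM: "N * (M + 1) > 0" using N M by simp
  have "(M - 1) * (N * (M + 1)) < 0 \<longleftrightarrow> (1 - N) * (1 + N - t\<^sup>2) < 0"
       "0 < (M - 1) * (N * (M + 1)) \<longleftrightarrow> 0 < (1 - N) * (1 + N - t\<^sup>2)"
    by (simp_all only: k)
  then show "M < 1 \<longleftrightarrow> 1 < N" "1 < M \<longleftrightarrow> N < 1"
    using NM pos by (auto simp: mult_less_0_iff zero_less_mult_iff)
  assume "N < 1"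
  have "1 - (N * M)\<^sup>2 = (1 - N) * (1 + t\<^sup>2 * N - N\<^sup>2)"
    using key by algebra
  moreover have "1 - N \<le> 1 + t\<^sup>2 * N - N\<^sup>2"
  proof -
    have "N\<^sup>2 \<le> N" using N(1) \<open>N < 1\<close> by (simp add: power2_eq_square mult_left_le)
    moreover have "0 \<le> t\<^sup>2 * N" using N by simp
    ultimately show ?thesis by linarith
  qed
  then have "(1 - N)\<^sup>2 \<le> (1 - N) * (1 + t\<^sup>2 * N - N\<^sup>2)"
    using \<open>N < 1\<close> by (simp add: power2_eq_square)
  ultimately show "(N * M)\<^sup>2 \<le> 1 - (1 - N)\<^sup>2" by linarith
qed

section \<open>A pair of points with asymptotic orbits\<close>

lemma not_distal_affine_sphere_map:
  fixes T :: "real^'d^'d" and d :: real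
  assumes T: "orthogonal_matrix T" and card: "CARD('d) \<ge> 2"
    and v: "norm v = 1" "T *v v = d *\<^sub>R v" and d: "d\<^sup>2 = 1"
    and t: "0 < t" "t < 1"
  shows "\<not> distal (top_of_set (sphere 0 1)) (affine_sphere_map T (t *\<^sub>R v))"
proof -
  define S where "S = affine_sphere_map T (t *\<^sub>R v)"
  define N where "N x = norm (t *\<^sub>R v + T *v x)" for x
  note facts = affine_sphere_map_inner[OF T v d _ t, folded S_def N_def]
  have bij: "bij_betw S (sphere 0 1) (sphere 0 1)"
    using homeomorphic_map_affine_sphere_map[OF T, of "t *\<^sub>R v"] v t
    by (simp add: S_def bij_betw_def homeomorphic_eq_everything_map)
  have nS: "norm (S x) = 1" if "norm x = 1" for x
    using bij_betwE[OF bij] that by simp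
  have "2 \<le> DIM(real^'d)" using card by simp
  then obtain u0 where u0: "u0 \<noteq> 0" "orthogonal v u0"
    by (rule orthogonal_to_vector_exists)
  define u where "u = (1 / norm u0) *\<^sub>R u0"
  have u: "norm u = 1" "v \<bullet> u = 0"
    using u0 by (simp_all add: u_def orthogonal_def)
  \<comment> \<open>A rational unit vector off the axis. Its height \<open>3/5\<close> exceeds
    \<open>1/2\<close>, which for \<open>d = -1\<close> ensures
    \<open>t < 2 * (v \<bullet> y)\<close> and hence \<open>N y < 1\<close> for every
    \<open>t < 1\<close>.\<close>
  define y where "y = (3/5) *\<^sub>R v + (4/5) *\<^sub>R u"
  have vy: "v \<bullet> y = 3/5"
    using u v by (simp add: y_def inner_add norm_eq_1)
  have ny: "norm y = 1"
    using u v by (simp add: y_def norm_eq_1 inner_add inner_commute)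
  have vny: "v \<noteq> y"
    using vy v by (auto simp: norm_eq_1)
  from d have "d = 1 \<or> d = -1" by (simp add: power2_eq_1_iff)
  then show ?thesis
  proof
    assume d1: "d = 1"
    have "v + t *\<^sub>R v = (1 + t) *\<^sub>R v" by (simp add: algebra_simps)
    then have Sv: "S v = v"
      using v t d1 by (simp add: S_def affine_sphere_map_def add.commute)
    have itv: "(S ^^ m) v = v" for m by (induction m) (simp_all add: Sv)
    define q where "q = 1 / (1 + t\<^sup>2)"
    have q: "0 \<le> q" "q < 1" using t by (simp_all add: q_def add_pos_pos)
    have iter: "norm ((S ^^ m) y) = 1 \<and> 0 \<le> v \<bullet> (S ^^ m) y \<and> 1 - (v \<bullet> (S ^^ m) y)\<^sup>2 \<le> q ^ m" for m
    proof (induction m)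
      case 0
      then show ?case using ny vy by simp
    next
      case (Suc m)
      define x where "x = (S ^^ m) y"
      have x: "norm x = 1" "0 \<le> v \<bullet> x" "1 - (v \<bullet> x)\<^sup>2 \<le> q ^ m"
        using Suc by (simp_all add: x_def)
      note f = facts[OF x(1)]
      have "1 + t\<^sup>2 \<le> (N x)\<^sup>2" using f(2) d1 x t by simp
      moreover have "0 < 1 + t\<^sup>2" by (simp add: add_pos_nonneg)
      ultimately have Nq: "1 / (N x)\<^sup>2 \<le> q"
        unfolding q_def by (intro frac_le) simp_all
      have "1 - (v \<bullet> S x)\<^sup>2 = (1 - (v \<bullet> x)\<^sup>2) * (1 / (N x)\<^sup>2)" using f(4) by simp
      also have "\<dots> \<le> q ^ m * q"
        using x(3) Nq q by (intro mult_mono) auto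
      finally show ?case
        using f(1,3) d1 x t nS by (simp add: x_def[symmetric] ac_simps)
    qed
    show ?thesis unfolding S_def[symmetric]
    proof (rule not_distalI[where k = int and x = v and y = y and d = v])
      show "(\<lambda>m. int_iterate (sphere 0 1) S (int m) y) \<longlonglongrightarrow> v"
        using unit_vectors_tendsto[of v "\<lambda>m. (S ^^ m) y" q] iter v q by (simp add: int_iterate_def)
    qed (use v ny vny iter in \<open>simp_all add: int_iterate_def itv\<close>)
  next
    assume d1: "d = -1"
    define R where "R = inv_into (sphere 0 1) S"
    have SR: "S (R x) = x" and nR: "norm (R x) = 1" if "norm x = 1" for x
      using bij_betw_inv_into_right[OF bij, of x] bij_betwE[OF bij_betw_inv_into[OF bij]] that
      by (auto simp: R_def)
    have RS: "R (S x) = x" if "norm x = 1" for x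
      using bij_betw_inv_into_left[OF bij, of x] that by (auto simp: R_def)
    have Sv: "S v = - v" "S (- v) = v"
    proof -
      have "t *\<^sub>R v - v = (1 - t) *\<^sub>R (- v)" "t *\<^sub>R v + v = (1 + t) *\<^sub>R v"
        by (simp_all add: algebra_simps)
      then show "S v = - v" "S (- v) = v"
        using v t d1 by (simp_all add: S_def affine_sphere_map_def vec.neg
            del: scaleR_minus_right)
    qed
    have Rv: "R (R v) = v"
      using RS[of v] RS[of "- v"] Sv v by simp
    define F where "F = R \<circ> R"
    have F: "R (R z) = F z" for z by (simp add: F_def)
    have ev: "R ^^ (2 * m) = F ^^ m" for m
      unfolding funpow_mult[symmetric] F_def by (simp add: numeral_2_eq_2)
    have itv: "(F ^^ m) v = v" for m by (induction m) (simp_all add: Rv[unfolded F])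
    \<comment> \<open>For \<open>d = -1\<close>, \<open>n0\<close> is the value of \<open>N\<close>
      at height \<open>3/5\<close> and bounds \<open>N\<close> at all greater heights. As
      \<open>1 - (1 - N)^2\<close> increases for \<open>N < 1\<close>, \<open>q\<close> is a uniform
      contraction factor in the two-step estimate.\<close>
    define n0 where "n0 = sqrt (1 + t\<^sup>2 - 6/5 * t)"
    define q where "q = 1 - (1 - n0)\<^sup>2"
    have n0: "0 \<le> n0" "n0 < 1"
    proof -
      have "0 \<le> (t - 3/5)\<^sup>2 + 16/25" by simp
      also have "\<dots> = 1 + t\<^sup>2 - 6/5 * t" by (simp add: power2_eq_square algebra_simps)
      finally show "0 \<le> n0" by (simp add: n0_def)
      have "t\<^sup>2 < t" using t by (simp add: power2_eq_square)
      then show "n0 < 1" using t by (simp add: n0_def)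
    qed
    have q: "0 \<le> q" "q < 1"
      using n0 by (simp_all add: q_def power_le_one)
    have step: "norm (R (R z)) = 1 \<and> 3/5 \<le> v \<bullet> R (R z) \<and>
        1 - (v \<bullet> R (R z))\<^sup>2 \<le> q * (1 - (v \<bullet> z)\<^sup>2)"
      if z: "norm z = 1" "3/5 \<le> v \<bullet> z" for z
    proof -
      \<comment> \<open>Naming the preimages makes \<open>x\<close>, \<open>w\<close>,
        \<open>z\<close> a forward orbit, to which the formulas for \<open>S\<close> apply.\<close>
      define w x where "w = R z" and "x = R w"
      have nwx: "norm w = 1" "norm x = 1" using nR z by (simp_all add: w_def x_def)
      have Sx: "S x = w" "S w = z" using SR z nwx by (simp_all add: w_def x_def)
      note fx = facts[OF nwx(2), unfolded Sx d1, simplified]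
      note fw = facts[OF nwx(1), unfolded Sx d1, simplified]
      note fz = facts[OF z(1), unfolded d1, simplified]
      have "t * (3/5) \<le> t * (v \<bullet> z)" using z(2) t(1) by (intro mult_left_mono) auto
      moreover have "t\<^sup>2 < t" using t by (simp add: power2_eq_square)
      ultimately have "(N z)\<^sup>2 < 1" using fz(2) t by linarith
      then have "N z < 1" using fz(1) by (simp add: power_less_one_iff abs_square_less_1)
      \<comment> \<open>The factors alternate around \<open>1\<close>, so \<open>N z < 1\<close>
        propagates backwards to \<open>1 < N w\<close> and then to \<open>N x < 1\<close>, before
        anything is known about the heights of \<open>w\<close> and \<open>x\<close>.\<close>
      then have "1 < N w"
        using two_step_factors(1)[OF t fw(1,2) fz(1)] fw(3) fz(2) by simp
      then have Nx: "N x < 1"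
        using two_step_factors(2)[OF t fx(1,2) fw(1)] fx(3) fw(2) by simp
      have prod: "(N x * N w)\<^sup>2 \<le> 1 - (1 - N x)\<^sup>2"
        using two_step_factors(3)[OF t fx(1,2) fw(1)] fx(3) fw(2) Nx by simp
      have "(N x)\<^sup>2 < 1" using Nx fx(1) by (simp add: power_less_one_iff)
      then have "t * t < t * (2 * (v \<bullet> x))" using fx(2) by (simp add: power2_eq_square)
      then have cx: "0 < v \<bullet> x" using t by simp
      have cz: "(v \<bullet> z)\<^sup>2 \<le> 1"
        using Cauchy_Schwarz_ineq2[of v z] v z by (simp add: abs_square_le_1)
      have eq: "1 - (v \<bullet> x)\<^sup>2 = (N x * N w)\<^sup>2 * (1 - (v \<bullet> z)\<^sup>2)"
      proof -
        have "1 - (v \<bullet> x)\<^sup>2 = (N x)\<^sup>2 * (1 - (v \<bullet> w)\<^sup>2)"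
          using fx(1,4) by simp
        moreover have "1 - (v \<bullet> w)\<^sup>2 = (N w)\<^sup>2 * (1 - (v \<bullet> z)\<^sup>2)"
          using fw(1,4) by simp
        ultimately show ?thesis by (simp only: power_mult_distrib mult.assoc)
      qed
      \<comment> \<open>First a factor of at most \<open>1\<close> shows that the height does not
        drop below that of \<open>z\<close>. The bound \<open>3/5\<close> thus persists at
        \<open>x\<close>, yields \<open>N x \<le> n0\<close>, and sharpens the factor to
        \<open>q\<close>.\<close>
      have "(N x * N w)\<^sup>2 \<le> 1" using prod zero_le_power2[of "1 - N x"] by linarith
      then have "1 - (v \<bullet> x)\<^sup>2 \<le> 1 - (v \<bullet> z)\<^sup>2"
        unfolding eq using cz by (intro mult_left_le_one_le) auto
      then have "(v \<bullet> z)\<^sup>2 \<le> (v \<bullet> x)\<^sup>2" by simp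
      then have "v \<bullet> z \<le> v \<bullet> x" using cx by (rule power2_le_imp_le[OF _ less_imp_le])
      then have c35: "3/5 \<le> v \<bullet> x" using z by linarith
      have "t * (3/5) \<le> t * (v \<bullet> x)" using c35 t(1) by (intro mult_left_mono) auto
      then have "(N x)\<^sup>2 \<le> 1 + t\<^sup>2 - 6/5 * t" using fx(2) by simp
      then have "N x \<le> n0" unfolding n0_def by (rule real_le_rsqrt)
      then have "(1 - n0)\<^sup>2 \<le> (1 - N x)\<^sup>2" using n0 by (intro power_mono) auto
      then have "(N x * N w)\<^sup>2 \<le> q" using prod by (simp add: q_def)
      then have "1 - (v \<bullet> x)\<^sup>2 \<le> q * (1 - (v \<bullet> z)\<^sup>2)"
        unfolding eq using cz by (intro mult_right_mono) auto
      then show ?thesis using c35 nwx by (simp add: x_def w_def)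
    qed
    have iter: "norm ((F ^^ m) y) = 1 \<and> 3/5 \<le> v \<bullet> (F ^^ m) y \<and>
        1 - (v \<bullet> (F ^^ m) y)\<^sup>2 \<le> q ^ m" for m
    proof (induction m)
      case 0
      then show ?case using ny vy by simp
    next
      case (Suc m)
      define x where "x = (F ^^ m) y"
      have x: "norm x = 1" "3/5 \<le> v \<bullet> x" "1 - (v \<bullet> x)\<^sup>2 \<le> q ^ m"
        using Suc by (simp_all add: x_def)
      have "q * (1 - (v \<bullet> x)\<^sup>2) \<le> q * q ^ m"
        using x(3) q(1) by (rule mult_left_mono)
      then show ?case using step[OF x(1,2)] by (simp add: x_def[symmetric] F)
    qed
    have nonneg: "0 \<le> v \<bullet> (F ^^ m) y" for m
      using iter[of m] by linarith
    have it: "int_iterate (sphere 0 1) S (- int (2 * m)) = F ^^ m" for m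
    \<comment> \<open>Time zero falls under the nonnegative branch of \<open>int_iterate\<close> and
      is treated apart.\<close>
    proof (cases "m = 0")
      case False
      then have "\<not> 0 \<le> - int (2 * m)" by simp
      moreover have "nat (- (- int (2 * m))) = 2 * m" by simp
      ultimately show ?thesis
        unfolding int_iterate_def R_def[symmetric] by (simp only: if_False ev)
    qed (simp add: int_iterate_def)
    show ?thesis unfolding S_def[symmetric]
    proof (rule not_distalI[where k = "\<lambda>m. - int (2 * m)" and x = v and y = y and d = v])
      show "(\<lambda>m. int_iterate (sphere 0 1) S (- int (2 * m)) y) \<longlonglongrightarrow> v"
        unfolding it using unit_vectors_tendsto[of v "\<lambda>m. (F ^^ m) y" q] v(1) q iter nonneg by blast
    qed (use v ny vny iter in \<open>simp_all only: it itv mem_sphere_0 tendsto_const not_False_eq_True\<close>)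
  qed
qed

theorem corollary12:
  fixes n :: nat and T :: "real^'d^'d"
  assumes "n \<ge> 1" and "even n" and "CARD('d) = n + 1"
    and "invertible T"
    and "\<forall>x y. dist (T *v x) (T *v y) = dist x y"
  shows "\<exists>a :: real^'d. 0 < norm (matrix_inv T *v a) \<and> norm (matrix_inv T *v a) < 1 \<and>
           homeomorphic_map (top_of_set (sphere 0 1)) (top_of_set (sphere 0 1))
             (affine_sphere_map T a) \<and>
           \<not> distal (top_of_set (sphere 0 1)) (affine_sphere_map T a)"
proof -
  have orth: "orthogonal_transformation ((*v) T)"
    using assms(5) by (simp add: orthogonal_transformation_isometry)
  then have T: "orthogonal_matrix T"
    by (simp add: orthogonal_transformation_matrix_vector_mult)
  obtain v where v: "norm v = 1" "T *v v = det T *\<^sub>R v"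
    using orthogonal_matrix_real_eigenvector[OF T] assms(2,3) by auto
  have d: "(det T)\<^sup>2 = 1"
    using det_orthogonal_matrix[OF T] by auto
  have "T ** matrix_inv T = mat 1"
    using assms(4) unfolding invertible_def matrix_inv_def by (rule someI2_ex) simp
  then have "T *v (matrix_inv T *v x) = x" for x
    by (simp add: matrix_vector_mul_assoc)
  then have "norm (matrix_inv T *v x) = norm x" for x
    by (metis orth orthogonal_transformation_norm)
  \<comment> \<open>The factor \<open>1/2\<close> is an arbitrary choice in the open interval from
    \<open>0\<close> to \<open>1\<close>.\<close>
  moreover have "\<not> distal (top_of_set (sphere 0 1)) (affine_sphere_map T ((1/2) *\<^sub>R v))"
    using not_distal_affine_sphere_map[OF T _ v d] assms(1,3) by simp
  ultimately show ?thesis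
    using homeomorphic_map_affine_sphere_map[OF T, of "(1/2) *\<^sub>R v"] v
    by (intro exI[of _ "(1/2) *\<^sub>R v"]) simp
qed

end
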